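(* Let $Q\in \mathbb{Z}[x_1,x_2,x_3]$ be a non-singular quadratic form, let $B_1,B_2,B_3\ge 1$, $\mathbf{B}=(B_1,B_2,B_3)$ and $V=B_1B_2B_3$. Then $$ N(Q;\mathbf{B})\ll V^{1/3}, $$ with an absolute implied constant.
   Context: $N(Q;\mathbf{B})=\#\{\mathbf{x} \in \mathbb{Z}^3: \mathrm{h.c.f.}(x_1,x_2,x_3)=1,\ Q(\mathbf{x})=0, ~|x_i| \leq B_i ~(1\leq i \leq 3)\}$. *)

theory Defs
  imports "HOL-Analysis.Analysis"
begin

text \<open>
  The form with coefficients \<open>a\<^sub>i\<^sub>j\<close> is
  \<open>\<Sum>i\<le>j. a\<^sub>i\<^sub>j x\<^sub>i x\<^sub>j\<close>. The cross coefficients are arbitrary integers,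
  so the symmetric matrix of the form may have half-integral entries.
\<close>

datatype ternary_form =
  Ternary_Form (c11: int) (c22: int) (c33: int) (c12: int) (c13: int) (c23: int)

definition form_eval :: "ternary_form \<Rightarrow> 'a::comm_ring_1 ^ 3 \<Rightarrow> 'a" where
  "form_eval Q x =
     of_int (c11 Q) * (x $ 1)\<^sup>2 + of_int (c22 Q) * (x $ 2)\<^sup>2 + of_int (c33 Q) * (x $ 3)\<^sup>2
   + of_int (c12 Q) * x $ 1 * x $ 2 + of_int (c13 Q) * x $ 1 * x $ 3
   + of_int (c23 Q) * x $ 2 * x $ 3"

definition form_matrix :: "ternary_form \<Rightarrow> rat ^ 3 ^ 3" where
  "form_matrix Q = vector
     [vector [of_int (c11 Q), of_int (c12 Q) / 2, of_int (c13 Q) / 2],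
      vector [of_int (c12 Q) / 2, of_int (c22 Q), of_int (c23 Q) / 2],
      vector [of_int (c13 Q) / 2, of_int (c23 Q) / 2, of_int (c33 Q)]]"

lemma form_matrix_symmetric: "transpose (form_matrix Q) = form_matrix Q"
  by (simp add: vec_eq_iff forall_3 transpose_def form_matrix_def)

lemma form_eval_eq_matrix:
  fixes x :: "rat ^ 3"
  shows "form_eval Q x = (\<Sum>i\<in>UNIV. \<Sum>j\<in>UNIV. form_matrix Q $ i $ j * x $ i * x $ j)"
  by (simp add: form_eval_def form_matrix_def sum_3 power2_eq_square algebra_simps)

definition nonsingular :: "ternary_form \<Rightarrow> bool" where
  "nonsingular Q \<longleftrightarrow> det (form_matrix Q) \<noteq> 0"

definition N :: "ternary_form \<Rightarrow> real ^ 3 \<Rightarrow> nat" where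
  "N Q B = card {x :: int ^ 3.
     Gcd {x $ 1, x $ 2, x $ 3} = 1 \<and> form_eval Q x = 0 \<and>
     (\<forall>i. real_of_int \<bar>x $ i\<bar> \<le> B $ i)}"

text \<open>The set counted by \<open>N\<close> is finite, so its \<open>card\<close> is a genuine count.\<close>

lemma finite_N_set:
  fixes B :: "real ^ 3"
  shows "finite {x :: int ^ 3.
     Gcd {x $ 1, x $ 2, x $ 3} = 1 \<and> form_eval Q x = 0 \<and>
     (\<forall>i. real_of_int \<bar>x $ i\<bar> \<le> B $ i)}" (is "finite ?S")
proof -
  define K where "K i = {- \<lfloor>B $ i\<rfloor> .. \<lfloor>B $ i\<rfloor>}" for i
  have "?S \<subseteq> (\<lambda>(a, b, c). vector [a, b, c]) ` (K 1 \<times> K 2 \<times> K 3)"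
  proof
    fix x assume x: "x \<in> ?S"
    have "x $ i \<in> K i" for i
    proof -
      have "real_of_int \<bar>x $ i\<bar> \<le> B $ i"
        using x by blast
      then have "\<bar>x $ i\<bar> \<le> \<lfloor>B $ i\<rfloor>"
        by (simp only: le_floor_iff)
      then show ?thesis
        unfolding K_def by auto
    qed
    moreover have "x = vector [x $ 1, x $ 2, x $ 3]"
      by (simp add: vec_eq_iff forall_3)
    ultimately show "x \<in> (\<lambda>(a, b, c). vector [a, b, c]) ` (K 1 \<times> K 2 \<times> K 3)"
      by (intro image_eqI[where x = "(x $ 1, x $ 2, x $ 3)"]) auto
  qed
  moreover have "finite (K i)" for i
    by (simp add: K_def)
  ultimately show ?thesis
    by (meson finite_SigmaI finite_imageI finite_subset)
qed

end

theory Submission imports Defs begin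

text \<open>
  Three pairwise non-proportional integer zeros of a nonsingular form have a nonzero integer
  determinant. Rescale the box to the unit cube and project each zero from the origin onto the
  surface of the cube: on a face the zeros become points of a plane conic in a square, and any
  three of them span a triangle of area at least \<open>1 / (2 * V)\<close>. The conic splits into a bounded
  number of convex arcs. For consecutive points of a convex arc the area is at most the product of
  two edge lengths and the turning angle, so \<open>V powr (- 1 / 3)\<close> is at most their sum up to a
  constant; total length and total turning are bounded, which leaves \<open>O(V powr (1 / 3))\<close> points
  on each arc.
\<close>

section \<open>Sequences of plane points in convex position\<close>

text \<open>The cross product of two consecutive edges, that is, twice the signed area of the
  triangle; it is positive for a left turn.\<close>

definition orient :: "real \<Rightarrow> real \<Rightarrow> real \<Rightarrow> real \<Rightarrow> real \<Rightarrow> real \<Rightarrow> real" where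
  "orient x1 y1 x2 y2 x3 y3 = (x2 - x1) * (y3 - y2) - (x3 - x2) * (y2 - y1)"

text \<open>By \<open>mono\<close> the sequence first falls and then rises, so its variation
  consists of two swings of size at most \<open>2 * K\<close>.\<close>

lemma sum_abs_diff_convex_le:
  fixes y :: "nat \<Rightarrow> real"
  assumes bound: "\<And>i. i \<le> m \<Longrightarrow> \<bar>y i\<bar> \<le> K"
    and mono: "\<And>i. Suc i < m \<Longrightarrow> y i \<le> y (Suc i) \<Longrightarrow> y (Suc i) \<le> y (Suc (Suc i))"
  shows "(\<Sum>i<m. \<bar>y (Suc i) - y i\<bar>) \<le> 4 * K"
proof -
  \<comment> \<open>The first alternative is the falling phase. After a minimum \<open>y j\<close>
    the sum is \<open>y 0 - 2 * y j + y k\<close>, whence \<open>3 * K + y k\<close>.\<close>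
  have "(\<Sum>i<k. \<bar>y (Suc i) - y i\<bar>) = y 0 - y k
      \<or> 0 < k \<and> y (k - 1) \<le> y k \<and> (\<Sum>i<k. \<bar>y (Suc i) - y i\<bar>) \<le> 3 * K + y k"
    if "k \<le> m" for k
    using that
  proof (induction k)
    case (Suc k)
    have "\<bar>y 0\<bar> \<le> K" "\<bar>y k\<bar> \<le> K" using bound Suc.prems by auto
    moreover have "y k \<le> y (Suc k)" if "0 < k" "y (k - 1) \<le> y k"
      using mono[of "k - 1"] that Suc.prems by simp
    moreover have "k \<le> m" using Suc.prems by simp
    ultimately show ?case using Suc.IH by (cases "y k \<le> y (Suc k)") auto
  qed simp
  from this[of m] bound[of m] bound[of 0] show ?thesis by (simp add: abs_le_iff) linarith
qed

text \<open>A crude form of the inequality of arithmetic and geometric means: each factor is at most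
  the sum.\<close>

lemma cube_le_prod_imp_le_sum:
  fixes a b c t :: real
  assumes "t ^ 3 \<le> a * b * c" "0 \<le> a" "0 \<le> b" "0 \<le> c"
  shows "t \<le> a + b + c"
proof -
  have "a * b * c \<le> (a + b + c) * (a + b + c) * (a + b + c)"
    using assms by (intro mult_mono) auto
  then have "t ^ Suc 2 \<le> (a + b + c) ^ Suc 2"
    using assms(1) by (simp add: power3_eq_cube)
  then show ?thesis by (rule power_le_imp_le_base) (use assms in simp)
qed

text \<open>For an edge \<open>(p, q)\<close> the bounded quantity \<open>q / (p + \<bar>q\<bar>)\<close> is increasing in the slope
  and plays the role of its angle, \<open>p + \<bar>q\<bar>\<close> that of its length.\<close>

lemma cross_le_length_angle:
  fixes p q p' q' :: real
  assumes "0 < p" "0 < p'" "0 \<le> p * q' - p' * q"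
  shows "p * q' - p' * q \<le> (p + \<bar>q\<bar>) * (p' + \<bar>q'\<bar>) * (q' / (p' + \<bar>q'\<bar>) - q / (p + \<bar>q\<bar>))"
proof -
  have "(p + \<bar>q\<bar>) * (p' + \<bar>q'\<bar>) * (q' / (p' + \<bar>q'\<bar>) - q / (p + \<bar>q\<bar>))
      = (p + \<bar>q\<bar>) * q' - (p' + \<bar>q'\<bar>) * q"
    using assms by (simp add: field_simps add_pos_nonneg less_imp_neq[symmetric])
  \<comment> \<open>This is the excess of the right-hand side over the cross product. It is negative
    only if \<open>q' < 0 < q\<close>, a right turn, which the last assumption excludes.\<close>
  moreover have "0 \<le> \<bar>q\<bar> * q' - \<bar>q'\<bar> * q"
  proof (cases "0 < q \<and> q' < 0")
    case True
    then have "p * q' < 0" "0 < p' * q"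
      using assms by (auto simp: mult_pos_neg)
    then show ?thesis using assms by linarith
  next
    case False
    then show ?thesis
      by (auto simp: abs_if mult_nonneg_nonpos mult_nonpos_nonneg not_less)
  qed
  ultimately show ?thesis by (simp add: algebra_simps)
qed

text \<open>Each of the \<open>n - 2\<close> interior vertices gives
  \<open>t \<le> l i + l (Suc i) + (g (Suc i) - g i)\<close>. In the sum every edge occurs at most
  twice, contributing \<open>12 * K\<close> by a total length of at most \<open>6 * K\<close>, and
  the turning telescopes to at most 2. The two end points account for \<open>2 * t\<close>.\<close>

lemma convex_sequence_bound:
  fixes x y :: "nat \<Rightarrow> real" and t K :: real
  assumes t: "0 < t"
    and bx: "\<And>i. i < n \<Longrightarrow> \<bar>x i\<bar> \<le> K" and by': "\<And>i. i < n \<Longrightarrow> \<bar>y i\<bar> \<le> K" and K: "0 \<le> K"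
    and inc: "\<And>i. Suc i < n \<Longrightarrow> x i < x (Suc i)"
    and conv: "\<And>i. Suc (Suc i) < n \<Longrightarrow>
      t ^ 3 \<le> orient (x i) (y i) (x (Suc i)) (y (Suc i)) (x (Suc (Suc i))) (y (Suc (Suc i)))"
  shows "real n * t \<le> 2 * t + (12 * K + 2)"
proof (cases "n \<le> 2")
  case True
  then have "real n * t \<le> 2 * t" using t by (intro mult_right_mono) auto
  then show ?thesis using K by simp
next
  case False
  then obtain m where n: "n = Suc (Suc m)" by (metis add_2_eq_Suc le_Suc_ex nat_le_linear)
  define dx where "dx i = x (Suc i) - x i" for i
  define dy where "dy i = y (Suc i) - y i" for i
  define l where "l i = dx i + \<bar>dy i\<bar>" for i
  define g where "g i = dy i / l i" for i
  have dx: "0 < dx i" if "i \<le> m" for i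
    using inc[of i] that by (simp add: n dx_def)
  have l: "0 < l i" if "i \<le> m" for i
    using dx[OF that] by (simp add: l_def)
  have g: "\<bar>g i\<bar> \<le> 1" if "i \<le> m" for i
    using l[OF that] dx[OF that] by (simp add: g_def abs_divide divide_le_eq_1 l_def)
  have det: "t ^ 3 \<le> dx i * dy (Suc i) - dx (Suc i) * dy i" if "i < m" for i
    using conv[of i] that by (simp add: n orient_def dx_def dy_def)
  have t3: "0 < t ^ 3" using t by simp
  have cr: "t ^ 3 \<le> l i * l (Suc i) * (g (Suc i) - g i)" if "i < m" for i
    using cross_le_length_angle[of "dx i" "dx (Suc i)" "dy (Suc i)" "dy i"] det[OF that] dx[of i] dx[of "Suc i"] t3 that
    by (simp add: g_def l_def)
  have step: "t \<le> l i + l (Suc i) + (g (Suc i) - g i)" if "i < m" for i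
  proof (rule cube_le_prod_imp_le_sum[OF cr[OF that]])
    show l0: "0 \<le> l i" "0 \<le> l (Suc i)" using l[of i] l[of "Suc i"] that by auto
    have "0 < l i * l (Suc i)" using l[of i] l[of "Suc i"] that by simp
    moreover have "0 < l i * l (Suc i) * (g (Suc i) - g i)" using cr[OF that] t3 by linarith
    ultimately show "0 \<le> g (Suc i) - g i" by (metis less_imp_le zero_less_mult_pos)
  qed
  \<comment> \<open>Slopes increase along the sequence, so after one rise it keeps rising; this
    bounds the vertical variation by \<open>4 * K\<close>.\<close>
  have dymono: "y (Suc i) \<le> y (Suc (Suc i))" if "Suc i < Suc m" "y i \<le> y (Suc i)" for i
  proof -
    have "0 < dx i * dy (Suc i) - dx (Suc i) * dy i" using det[of i] t3 that by linarith
    moreover have "0 \<le> dx (Suc i) * dy i" using dx[of "Suc i"] that by (simp add: dy_def)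
    ultimately have "0 < dx i * dy (Suc i)" by linarith
    then show ?thesis using dx[of i] that by (simp add: zero_less_mult_iff dy_def)
  qed
  have "(\<Sum>i<Suc m. \<bar>dy i\<bar>) \<le> 4 * K"
    unfolding dy_def by (rule sum_abs_diff_convex_le) (use by' n dymono in auto)
  moreover have "(\<Sum>i<Suc m. dx i) = x (Suc m) - x 0"
    unfolding dx_def by (rule sum_lessThan_telescope)
  moreover have "x (Suc m) - x 0 \<le> 2 * K" using bx[of "Suc m"] bx[of 0] n by simp
  ultimately have L: "(\<Sum>i<Suc m. l i) \<le> 6 * K"
    unfolding l_def sum.distrib by linarith
  have "(\<Sum>i<m. l i) \<le> (\<Sum>i<Suc m. l i)" using l[of m] by simp
  moreover have "(\<Sum>i<m. l (Suc i)) \<le> (\<Sum>i<Suc m. l i)"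
    using l[of 0] unfolding sum.lessThan_Suc_shift by simp
  moreover have "(\<Sum>i<m. g (Suc i) - g i) = g m - g 0" by (rule sum_lessThan_telescope)
  moreover have "g m - g 0 \<le> 2" using g[of m] g[of 0] by simp
  moreover have "real m * t \<le> (\<Sum>i<m. l i + l (Suc i) + (g (Suc i) - g i))"
    using sum_mono[of "{..<m}" "\<lambda>_. t", OF step] by simp
  ultimately have "real m * t \<le> 12 * K + 2"
    using L unfolding sum.distrib by linarith
  then show ?thesis by (simp add: n algebra_simps)
qed

text \<open>Sorting \<open>S\<close> by abscissa, which is possible as \<open>X\<close> is injective
  on it, reduces the claim to sequences.\<close>

lemma convex_set_bound:
  fixes X Y :: "'a \<Rightarrow> real" and t K :: real
  assumes t: "0 < t" and fin: "finite S" and inj: "inj_on X S"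
    and bx: "\<And>s. s \<in> S \<Longrightarrow> \<bar>X s\<bar> \<le> K" and by': "\<And>s. s \<in> S \<Longrightarrow> \<bar>Y s\<bar> \<le> K" and K: "0 \<le> K"
    and conv: "\<And>p q r. p \<in> S \<Longrightarrow> q \<in> S \<Longrightarrow> r \<in> S \<Longrightarrow> X p < X q \<Longrightarrow> X q < X r \<Longrightarrow>
      t ^ 3 \<le> orient (X p) (Y p) (X q) (Y q) (X r) (Y r)"
  shows "real (card S) * t \<le> 2 * t + (12 * K + 2)"
proof -
  define xs where "xs = sorted_list_of_set (X ` S)"
  have len: "length xs = card S"
    by (simp add: xs_def card_image[OF inj])
  have set: "set xs = X ` S" using fin by (simp add: xs_def)
  define p where "p i = inv_into S X (xs ! i)" for i
  have p: "p i \<in> S" "X (p i) = xs ! i" if "i < card S" for i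
    using that set len nth_mem[of i xs] by (auto simp: p_def inv_into_into f_inv_into_f)
  have inc: "X (p i) < X (p (Suc i))" if "Suc i < card S" for i
    using that sorted_wrt_nth_less[of "(<)" xs i "Suc i"] len
    by (simp add: p xs_def)
  show ?thesis
    by (rule convex_sequence_bound[where x = "\<lambda>i. X (p i)" and y = "\<lambda>i. Y (p i)"])
      (use t K bx by' p(1) inc conv in auto)
qed

section \<open>Convexity of square roots of quadratics, and points on a conic\<close>

text \<open>The sign condition on \<open>2 * \<alpha> * x + \<beta>\<close> puts both points on the same branch of the
  hyperbola \<open>w\<^sup>2 = \<alpha> * x\<^sup>2 + \<beta> * x + \<gamma>\<close>.\<close>

lemma polar_nonneg:
  fixes \<alpha> \<beta> \<gamma> x z :: real
  assumes "0 \<le> \<alpha> * x\<^sup>2 + \<beta> * x + \<gamma>" "0 \<le> \<alpha> * z\<^sup>2 + \<beta> * z + \<gamma>"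
    and disc: "0 \<le> \<beta>\<^sup>2 - 4 * \<alpha> * \<gamma>"
    and branch: "0 \<le> (2 * \<alpha> * x + \<beta>) * (2 * \<alpha> * z + \<beta>)"
  shows "0 \<le> \<alpha> * x * z + \<beta> * (x + z) / 2 + \<gamma>"
proof -
  define u v where "u = 2 * \<alpha> * x + \<beta>" and "v = 2 * \<alpha> * z + \<beta>"
  define d where "d = \<beta>\<^sup>2 - 4 * \<alpha> * \<gamma>"
  \<comment> \<open>Multiplication by \<open>4 * \<alpha>\<close> completes the squares. For
    \<alpha> > 0 it remains to deduce \<open>d \<le> u * v\<close> from
    \<open>d \<le> u\<^sup>2\<close> and \<open>d \<le> v\<^sup>2\<close>, where the branch
    condition fixes the sign of \<open>u * v\<close>; for \<alpha> < 0 both squares are at most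
    \<open>d\<close>, hence so is \<open>u * v\<close>. For \<alpha> = 0 the polar value is the mean
    of the two given values.\<close>
  have u: "4 * \<alpha> * (\<alpha> * x\<^sup>2 + \<beta> * x + \<gamma>) = u\<^sup>2 - d"
    and v: "4 * \<alpha> * (\<alpha> * z\<^sup>2 + \<beta> * z + \<gamma>) = v\<^sup>2 - d"
    and uv: "4 * \<alpha> * (\<alpha> * x * z + \<beta> * (x + z) / 2 + \<gamma>) = u * v - d"
    by (simp_all add: u_def v_def d_def power2_eq_square algebra_simps)
  consider "\<alpha> = 0" | "0 < \<alpha>" | "\<alpha> < 0" by linarith
  then show ?thesis
  proof cases
    case 1
    then show ?thesis using assms(1,2) by (simp add: field_simps)
  next
    case 2
    have "0 \<le> u\<^sup>2 - d" "0 \<le> v\<^sup>2 - d"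
      unfolding u[symmetric] v[symmetric] using 2 assms(1,2) by simp_all
    then have "d * d \<le> u\<^sup>2 * v\<^sup>2"
      using disc by (intro mult_mono) (auto simp: d_def)
    then have "d\<^sup>2 \<le> (u * v)\<^sup>2" by (simp add: power2_eq_square algebra_simps)
    then have "d \<le> u * v"
      using branch by - (rule power2_le_imp_le, auto simp: u_def v_def)
    then have "0 \<le> 4 * \<alpha> * (\<alpha> * x * z + \<beta> * (x + z) / 2 + \<gamma>)" unfolding uv by simp
    then show ?thesis using 2 by (simp only: zero_le_mult_iff) auto
  next
    case 3
    have "u\<^sup>2 - d \<le> 0" "v\<^sup>2 - d \<le> 0"
      unfolding u[symmetric] v[symmetric] using 3 assms(1,2) by (simp_all add: mult_nonpos_nonneg)
    moreover have "0 \<le> (u - v)\<^sup>2" by simp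
    ultimately have "u * v \<le> d" by (simp add: power2_eq_square algebra_simps)
    then have "4 * \<alpha> * (\<alpha> * x * z + \<beta> * (x + z) / 2 + \<gamma>) \<le> 0" unfolding uv by simp
    then show ?thesis using 3 by (simp only: mult_le_0_iff) auto
  qed
qed

text \<open>The height of the middle point and that of the chord are compared through their squares.
  The difference has the sign of \<open>b - w1 * w3\<close>, where \<open>b\<close> is the polar
  value of the quadratic at \<open>x1\<close> and \<open>x3\<close>, and
  \<open>b\<^sup>2 - (w1 * w3)\<^sup>2\<close> has the sign of the discriminant when that is
  nonzero. The concave case also needs \<open>0 \<le> b\<close>, which holds on a single
  branch.\<close>

lemma sqrt_quadratic_chord:
  fixes \<alpha> \<beta> \<gamma> x1 x2 x3 w1 w2 w3 :: real
  assumes x: "x1 < x2" "x2 < x3" and w: "0 \<le> w1" "0 \<le> w2" "0 \<le> w3"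
    and e: "w1\<^sup>2 = \<alpha> * x1\<^sup>2 + \<beta> * x1 + \<gamma>" "w2\<^sup>2 = \<alpha> * x2\<^sup>2 + \<beta> * x2 + \<gamma>"
      "w3\<^sup>2 = \<alpha> * x3\<^sup>2 + \<beta> * x3 + \<gamma>"
  shows sqrt_quadratic_concave:
      "0 \<le> \<beta>\<^sup>2 - 4 * \<alpha> * \<gamma> \<Longrightarrow> 0 \<le> (2 * \<alpha> * x1 + \<beta>) * (2 * \<alpha> * x3 + \<beta>) \<Longrightarrow>
        orient x1 w1 x2 w2 x3 w3 \<le> 0"
    and sqrt_quadratic_convex:
      "\<beta>\<^sup>2 - 4 * \<alpha> * \<gamma> < 0 \<Longrightarrow> 0 \<le> orient x1 w1 x2 w2 x3 w3"
proof -
  define b where "b = \<alpha> * x1 * x3 + \<beta> * (x1 + x3) / 2 + \<gamma>"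
  \<comment> \<open>The height of the chord above \<open>x2\<close>, multiplied by
    \<open>x3 - x1\<close>.\<close>
  define h where "h = (x3 - x2) * w1 + (x2 - x1) * w3"
  have h: "0 \<le> h" using x w by (simp add: h_def)
  have or: "orient x1 w1 x2 w2 x3 w3 = h - (x3 - x1) * w2"
    by (simp add: orient_def h_def algebra_simps)
  have b2: "b\<^sup>2 - (w1 * w3)\<^sup>2 = (\<beta>\<^sup>2 - 4 * \<alpha> * \<gamma>) / 4 * (x1 - x3)\<^sup>2"
    unfolding power_mult_distrib e b_def by (simp add: power2_eq_square field_simps)
  have "((x3 - x1) * w2)\<^sup>2 - h\<^sup>2
      = (x3 - x1)\<^sup>2 * w2\<^sup>2 - (x3 - x2)\<^sup>2 * w1\<^sup>2 - (x2 - x1)\<^sup>2 * w3\<^sup>2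
        - 2 * (x3 - x2) * (x2 - x1) * (w1 * w3)"
    by (simp add: h_def power2_eq_square algebra_simps)
  also have "\<dots> = 2 * ((x3 - x2) * (x2 - x1)) * (b - w1 * w3)"
    unfolding e b_def by (simp add: power2_eq_square field_simps)
  finally have d: "((x3 - x1) * w2)\<^sup>2 - h\<^sup>2 = 2 * ((x3 - x2) * (x2 - x1)) * (b - w1 * w3)" .
  have pos: "0 < (x3 - x2) * (x2 - x1)" using x by simp
  show "orient x1 w1 x2 w2 x3 w3 \<le> 0"
    if disc: "0 \<le> \<beta>\<^sup>2 - 4 * \<alpha> * \<gamma>" and br: "0 \<le> (2 * \<alpha> * x1 + \<beta>) * (2 * \<alpha> * x3 + \<beta>)"
  proof -
    have "0 \<le> b" unfolding b_def using e disc br by (intro polar_nonneg) (metis zero_le_power2)+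
    moreover have "0 \<le> b\<^sup>2 - (w1 * w3)\<^sup>2" unfolding b2 using disc by simp
    ultimately have "w1 * w3 \<le> b" by - (rule power2_le_imp_le, auto)
    then have "0 \<le> ((x3 - x1) * w2)\<^sup>2 - h\<^sup>2" unfolding d using pos by simp
    then have "h \<le> (x3 - x1) * w2" using x w by - (rule power2_le_imp_le, auto)
    then show ?thesis by (simp add: or)
  qed
  show "0 \<le> orient x1 w1 x2 w2 x3 w3" if disc: "\<beta>\<^sup>2 - 4 * \<alpha> * \<gamma> < 0"
  proof -
    have "b\<^sup>2 - (w1 * w3)\<^sup>2 \<le> 0" unfolding b2 using disc by (intro mult_nonpos_nonneg) auto
    then have "b \<le> w1 * w3" using w by - (rule power2_le_imp_le, auto)
    then have "((x3 - x1) * w2)\<^sup>2 - h\<^sup>2 \<le> 0" unfolding d using pos by (intro mult_nonneg_nonpos) auto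
    then have "(x3 - x1) * w2 \<le> h" using h by - (rule power2_le_imp_le, auto)
    then show ?thesis by (simp add: or)
  qed
qed

lemma exists_third:
  assumes "2 < card S"
  obtains r where "r \<in> S" "r \<noteq> p" "r \<noteq> q"
proof -
  have "\<not> S \<subseteq> {p, q}"
  proof
    assume "S \<subseteq> {p, q}"
    then have "card S \<le> card {p, q}" by (intro card_mono) auto
    also have "\<dots> \<le> 2" by (simp add: card_insert_if)
    finally show False using assms by simp
  qed
  then show ?thesis using that by blast
qed

text \<open>Adding an affine function of \<open>X\<close> to \<open>Y\<close> leaves
  \<open>orient\<close> unchanged, so the points may be viewed on the graph of the square root of a
  quadratic. The discriminant fixes the sign of every \<open>orient\<close>, and \<open>area\<close>
  turns this sign into a gap of \<open>t ^ 3\<close>.\<close>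

lemma arc_bound:
  fixes X Y :: "'a \<Rightarrow> real" and t K m k \<alpha> \<beta> \<gamma> :: real
  assumes t: "0 < t" and fin: "finite S"
    and bx: "\<And>s. s \<in> S \<Longrightarrow> \<bar>X s\<bar> \<le> K" and by': "\<And>s. s \<in> S \<Longrightarrow> \<bar>Y s\<bar> \<le> K" and K: "0 \<le> K"
    and curve: "\<And>s. s \<in> S \<Longrightarrow> (Y s + m * X s + k)\<^sup>2 = \<alpha> * (X s)\<^sup>2 + \<beta> * X s + \<gamma>"
    and upper: "\<And>s. s \<in> S \<Longrightarrow> 0 \<le> Y s + m * X s + k"
    and branch: "\<And>p q. p \<in> S \<Longrightarrow> q \<in> S \<Longrightarrow> 0 \<le> (2 * \<alpha> * X p + \<beta>) * (2 * \<alpha> * X q + \<beta>)"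
    and area: "\<And>p q r. p \<in> S \<Longrightarrow> q \<in> S \<Longrightarrow> r \<in> S \<Longrightarrow> p \<noteq> q \<Longrightarrow> q \<noteq> r \<Longrightarrow> p \<noteq> r \<Longrightarrow>
      t ^ 3 \<le> \<bar>orient (X p) (Y p) (X q) (Y q) (X r) (Y r)\<bar>"
  shows "real (card S) * t \<le> 2 * t + (12 * K + 2)"
proof (cases "card S \<le> 2")
  case True
  then have "real (card S) * t \<le> 2 * t" using t by (intro mult_right_mono) auto
  then show ?thesis using K by simp
next
  case False
  have t3: "0 < t ^ 3" using t by simp
  define W where "W s = Y s + m * X s + k" for s
  have orW: "orient (X p) (W p) (X q) (W q) (X r) (W r)
      = orient (X p) (Y p) (X q) (Y q) (X r) (Y r)" for p q r
    by (simp add: orient_def W_def algebra_simps)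
  \<comment> \<open>Points with equal abscissa coincide in the plane, since the root is nonnegative,
    and would form a degenerate triangle with any third point.\<close>
  have inj: "inj_on X S"
  proof (rule inj_onI, rule ccontr)
    fix p q assume pq: "p \<in> S" "q \<in> S" "X p = X q" "p \<noteq> q"
    obtain r where r: "r \<in> S" "r \<noteq> p" "r \<noteq> q"
      using exists_third[of S p q] False by auto
    have "W p = W q"
      using pq curve[of p] curve[of q] upper[of p] upper[of q]
      unfolding W_def by (metis power2_eq_iff_nonneg)
    then have "orient (X p) (Y p) (X q) (Y q) (X r) (Y r) = 0"
      using pq by (simp add: W_def orient_def)
    then show False using area[of p q r] r pq t3 by simp
  qed
  have ne: "t ^ 3 \<le> \<bar>orient (X p) (Y p) (X q) (Y q) (X r) (Y r)\<bar>"
    if "p \<in> S" "q \<in> S" "r \<in> S" "X p < X q" "X q < X r" for p q r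
    using that by (intro area) auto
  show ?thesis
  proof (cases "0 \<le> \<beta>\<^sup>2 - 4 * \<alpha> * \<gamma>")
    case True
    show ?thesis
    \<comment> \<open>Reflection in the horizontal axis turns the concave arc into a convex
      one.\<close>
    proof (rule convex_set_bound[where X = X and Y = "\<lambda>s. - Y s"])
      fix p q r assume h: "p \<in> S" "q \<in> S" "r \<in> S" "X p < X q" "X q < X r"
      have "orient (X p) (W p) (X q) (W q) (X r) (W r) \<le> 0"
        by (rule sqrt_quadratic_concave[OF h(4,5), of _ _ _ \<alpha> \<beta> \<gamma>])
          (use h(1-3)[THEN curve] h(1-3)[THEN upper] branch[OF h(1,3)] True in \<open>simp_all add: W_def\<close>)
      moreover have "orient (X p) (- Y p) (X q) (- Y q) (X r) (- Y r)
          = - orient (X p) (Y p) (X q) (Y q) (X r) (Y r)"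
        by (simp add: orient_def algebra_simps)
      ultimately show "t ^ 3 \<le> orient (X p) (- Y p) (X q) (- Y q) (X r) (- Y r)"
        using ne[OF h] orW[of p q r] by simp
    qed (use t fin inj bx by' K in auto)
  next
    case False
    show ?thesis
    proof (rule convex_set_bound[where X = X and Y = Y])
      fix p q r assume h: "p \<in> S" "q \<in> S" "r \<in> S" "X p < X q" "X q < X r"
      have "0 \<le> orient (X p) (W p) (X q) (W q) (X r) (W r)"
        by (rule sqrt_quadratic_convex[OF h(4,5), of _ _ _ \<alpha> \<beta> \<gamma>])
          (use h(1-3)[THEN curve] h(1-3)[THEN upper] False in \<open>simp_all add: W_def\<close>)
      then show "t ^ 3 \<le> orient (X p) (Y p) (X q) (Y q) (X r) (Y r)"
        using ne[OF h] orW[of p q r] by simp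
    qed (use t fin inj bx by' K in auto)
  qed
qed

text \<open>The signs of the root \<open>W\<close> and of the derivative \<open>u\<close> of the
  quadratic cut the curve into four arcs; those with \<open>W \<le> 0\<close> are reflected
  first.\<close>

lemma two_branched_curve_bound:
  fixes X Y :: "'a \<Rightarrow> real" and t K m k \<alpha> \<beta> \<gamma> :: real
  assumes t: "0 < t" and fin: "finite S"
    and bx: "\<And>s. s \<in> S \<Longrightarrow> \<bar>X s\<bar> \<le> K" and by': "\<And>s. s \<in> S \<Longrightarrow> \<bar>Y s\<bar> \<le> K" and K: "0 \<le> K"
    and curve: "\<And>s. s \<in> S \<Longrightarrow> (Y s + m * X s + k)\<^sup>2 = \<alpha> * (X s)\<^sup>2 + \<beta> * X s + \<gamma>"
    and area: "\<And>p q r. p \<in> S \<Longrightarrow> q \<in> S \<Longrightarrow> r \<in> S \<Longrightarrow> p \<noteq> q \<Longrightarrow> q \<noteq> r \<Longrightarrow> p \<noteq> r \<Longrightarrow>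
      t ^ 3 \<le> \<bar>orient (X p) (Y p) (X q) (Y q) (X r) (Y r)\<bar>"
  shows "real (card S) * t \<le> 4 * (2 * t + (12 * K + 2))"
proof -
  define u where "u s = 2 * \<alpha> * X s + \<beta>" for s
  define W where "W s = Y s + m * X s + k" for s
  have upper: "real (card T) * t \<le> 2 * t + (12 * K + 2)"
    if T: "T \<subseteq> S" "\<And>s. s \<in> T \<Longrightarrow> 0 \<le> W s" "\<And>p q. p \<in> T \<Longrightarrow> q \<in> T \<Longrightarrow> 0 \<le> u p * u q" for T
    by (rule arc_bound[of t T X K Y m k \<alpha> \<beta> \<gamma>])
      (use t K T finite_subset[OF T(1) fin] bx by' curve area in \<open>auto simp: u_def W_def subset_iff\<close>)
  have lower: "real (card T) * t \<le> 2 * t + (12 * K + 2)"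
    if T: "T \<subseteq> S" "\<And>s. s \<in> T \<Longrightarrow> W s \<le> 0" "\<And>p q. p \<in> T \<Longrightarrow> q \<in> T \<Longrightarrow> 0 \<le> u p * u q" for T
  proof (rule arc_bound[of t T X K "\<lambda>s. - Y s" "- m" "- k" \<alpha> \<beta> \<gamma>])
    fix s assume s: "s \<in> T"
    have neg: "- Y s + - m * X s + - k = - W s" by (simp add: W_def)
    show "(- Y s + - m * X s + - k)\<^sup>2 = \<alpha> * (X s)\<^sup>2 + \<beta> * X s + \<gamma>"
      and "0 \<le> - Y s + - m * X s + - k"
      unfolding neg power2_minus neg_0_le_iff_le using curve[of s] s T by (auto simp: W_def)
  next
    fix p q r assume "p \<in> T" "q \<in> T" "r \<in> T" "p \<noteq> q" "q \<noteq> r" "p \<noteq> r"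
    moreover have "orient (X p) (- Y p) (X q) (- Y q) (X r) (- Y r)
        = - orient (X p) (Y p) (X q) (Y q) (X r) (Y r)"
      by (simp add: orient_def algebra_simps)
    ultimately show "t ^ 3 \<le> \<bar>orient (X p) (- Y p) (X q) (- Y q) (X r) (- Y r)\<bar>"
      using area[of p q r] T(1) by auto
  qed (use t K T finite_subset[OF T(1) fin] bx by' in \<open>auto simp: u_def\<close>)
  define A1 where "A1 = {s \<in> S. 0 \<le> W s \<and> 0 \<le> u s}"
  define A2 where "A2 = {s \<in> S. 0 \<le> W s \<and> u s \<le> 0}"
  define A3 where "A3 = {s \<in> S. W s \<le> 0 \<and> 0 \<le> u s}"
  define A4 where "A4 = {s \<in> S. W s \<le> 0 \<and> u s \<le> 0}"
  have arcs: "real (card A1) * t \<le> 2 * t + (12 * K + 2)" "real (card A2) * t \<le> 2 * t + (12 * K + 2)"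
    "real (card A3) * t \<le> 2 * t + (12 * K + 2)" "real (card A4) * t \<le> 2 * t + (12 * K + 2)"
    by (rule upper lower; auto simp: A1_def A2_def A3_def A4_def mult_nonpos_nonpos)+
  have "S = A1 \<union> A2 \<union> A3 \<union> A4" by (auto simp: A1_def A2_def A3_def A4_def)
  then have "card S = card (A1 \<union> A2 \<union> A3 \<union> A4)" by (rule arg_cong)
  then have "card S \<le> card A1 + card A2 + card A3 + card A4"
    using card_Un_le[of "A1 \<union> A2 \<union> A3" A4] card_Un_le[of "A1 \<union> A2" A3] card_Un_le[of A1 A2]
    by linarith
  then have "real (card S) * t \<le> real (card A1 + card A2 + card A3 + card A4) * t"
    using t by (intro mult_right_mono) linarith+
  also have "\<dots> = real (card A1) * t + real (card A2) * t + real (card A3) * t + real (card A4) * t"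
    by (simp add: algebra_simps)
  also have "\<dots> \<le> (2 * t + (12 * K + 2)) + (2 * t + (12 * K + 2)) + (2 * t + (12 * K + 2)) + (2 * t + (12 * K + 2))"
    by (intro add_mono arcs)
  also have "\<dots> = 4 * (2 * t + (12 * K + 2))" by simp
  finally show ?thesis .
qed

lemma complete_square:
  fixes c y l n :: real
  assumes "c * y\<^sup>2 + l * y + n = 0"
  shows "(2 * c * y + l)\<^sup>2 = l\<^sup>2 - 4 * c * n"
  using assms by algebra

text \<open>A shear makes the coefficient of the squared ordinate nonzero while preserving
  \<open>orient\<close>; completing the square then gives a curve with two branches. A conic without
  quadratic part carries at most two of the points, because three would be collinear.\<close>

lemma conic_bound:
  fixes X Y :: "'a \<Rightarrow> real" and t a b c d e g :: real
  assumes t: "0 < t" and fin: "finite S"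
    and bx: "\<And>s. s \<in> S \<Longrightarrow> \<bar>X s\<bar> \<le> 1" and by': "\<And>s. s \<in> S \<Longrightarrow> \<bar>Y s\<bar> \<le> 1"
    and curve: "\<And>s. s \<in> S \<Longrightarrow>
      a * (X s)\<^sup>2 + b * X s * Y s + c * (Y s)\<^sup>2 + d * X s + e * Y s + g = 0"
    and nonzero: "\<not> (a = 0 \<and> b = 0 \<and> c = 0 \<and> d = 0 \<and> e = 0 \<and> g = 0)"
    and area: "\<And>p q r. p \<in> S \<Longrightarrow> q \<in> S \<Longrightarrow> r \<in> S \<Longrightarrow> p \<noteq> q \<Longrightarrow> q \<noteq> r \<Longrightarrow> p \<noteq> r \<Longrightarrow>
      t ^ 3 \<le> \<bar>orient (X p) (Y p) (X q) (Y q) (X r) (Y r)\<bar>"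
  shows "real (card S) * t \<le> 8 * t + 104"
proof (cases "a = 0 \<and> b = 0 \<and> c = 0")
  case True
  have "card S \<le> 2"
  proof (rule ccontr)
    assume "\<not> card S \<le> 2"
    then have c: "2 < card S" by simp
    obtain p where p: "p \<in> S" using exists_third[OF c] by blast
    obtain q where q: "q \<in> S" "q \<noteq> p" using exists_third[OF c, of p p] by blast
    obtain r where r: "r \<in> S" "r \<noteq> p" "r \<noteq> q" using exists_third[OF c, of p q] by blast
    have l: "d * X s + e * Y s + g = 0" if "s \<in> S" for s
      using curve[OF that] True by simp
    have de: "d \<noteq> 0 \<or> e \<noteq> 0" using l[OF p] nonzero True by auto
    have 1: "d * (X q - X p) + e * (Y q - Y p) = 0" "d * (X r - X q) + e * (Y r - Y q) = 0"
      using l[OF p] l[OF q(1)] l[OF r(1)] by (auto simp: algebra_simps)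
    \<comment> \<open>Both edges are orthogonal to the nonzero vector \<open>(d, e)\<close>, so they
      are proportional.\<close>
    have "d * orient (X p) (Y p) (X q) (Y q) (X r) (Y r)
        = (d * (X q - X p) + e * (Y q - Y p)) * (Y r - Y q)
          - (d * (X r - X q) + e * (Y r - Y q)) * (Y q - Y p)"
      "e * orient (X p) (Y p) (X q) (Y q) (X r) (Y r)
        = (d * (X r - X q) + e * (Y r - Y q)) * (X q - X p)
          - (d * (X q - X p) + e * (Y q - Y p)) * (X r - X q)"
      by (simp_all add: orient_def algebra_simps)
    then have "d * orient (X p) (Y p) (X q) (Y q) (X r) (Y r) = 0"
      "e * orient (X p) (Y p) (X q) (Y q) (X r) (Y r) = 0"
      unfolding 1 by simp_all
    then have "orient (X p) (Y p) (X q) (Y q) (X r) (Y r) = 0" using de by auto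
    then show False using area[of p q r] p q r t by simp
  qed
  then have "real (card S) * t \<le> 2 * t" using t by (intro mult_right_mono) auto
  then show ?thesis using t by linarith
next
  case False
  \<comment> \<open>A polynomial of degree at most 2 that vanishes at 0, 1 and -1 is zero. The bound
    on \<open>z\<close> keeps the sheared abscissa in \<open>[-2, 2]\<close>, hence
    \<open>K = 2\<close> below.\<close>
  have "\<exists>z. \<bar>z\<bar> \<le> 1 \<and> a * z\<^sup>2 + b * z + c \<noteq> 0"
  proof (rule ccontr)
    assume "\<not> ?thesis"
    then have "a * z\<^sup>2 + b * z + c = 0" if "\<bar>z\<bar> \<le> 1" for z using that by blast
    from this[of 0] this[of 1] this[of "- 1"] show False using False by simp
  qed
  then obtain z where z: "\<bar>z\<bar> \<le> 1" "a * z\<^sup>2 + b * z + c \<noteq> 0" by blast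
  \<comment> \<open>Substituting \<open>X = U + z * Y\<close>, these are the new coefficients of
    \<open>Y\<^sup>2\<close>, \<open>U * Y\<close> and \<open>Y\<close>.\<close>
  define c' b' e' where "c' = a * z\<^sup>2 + b * z + c" and "b' = 2 * a * z + b" and "e' = d * z + e"
  define U where "U s = X s - z * Y s" for s
  have c': "c' \<noteq> 0" using z by (simp add: c'_def)
  have "real (card S) * t \<le> 4 * (2 * t + (12 * 2 + 2))"
  proof (rule two_branched_curve_bound[where X = U and Y = Y and m = "b' / (2 * c')" and k = "e' / (2 * c')"
        and \<alpha> = "(b'\<^sup>2 - 4 * c' * a) / (4 * c'\<^sup>2)" and \<beta> = "(2 * b' * e' - 4 * c' * d) / (4 * c'\<^sup>2)"
        and \<gamma> = "(e'\<^sup>2 - 4 * c' * g) / (4 * c'\<^sup>2)"])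
    fix s assume s: "s \<in> S"
    have "\<bar>z * Y s\<bar> \<le> 1 * 1" unfolding abs_mult using z by'[OF s] by (intro mult_mono) auto
    then show "\<bar>U s\<bar> \<le> 2" using bx[OF s] by (simp add: U_def)
    show "\<bar>Y s\<bar> \<le> 2" using by'[OF s] by simp
    have "c' * (Y s)\<^sup>2 + (b' * U s + e') * Y s + (a * (U s)\<^sup>2 + d * U s + g) = 0"
      using curve[OF s] by (simp add: c'_def b'_def e'_def U_def power2_eq_square algebra_simps)
    then have *: "(2 * c' * Y s + (b' * U s + e'))\<^sup>2
        = (b' * U s + e')\<^sup>2 - 4 * c' * (a * (U s)\<^sup>2 + d * U s + g)"
      by (rule complete_square)
    have "(Y s + b' / (2 * c') * U s + e' / (2 * c'))\<^sup>2
        = (2 * c' * Y s + (b' * U s + e'))\<^sup>2 / (4 * c'\<^sup>2)"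
      using c' by (simp add: power2_eq_square field_simps)
    also have "\<dots> = (b'\<^sup>2 - 4 * c' * a) / (4 * c'\<^sup>2) * (U s)\<^sup>2
        + (2 * b' * e' - 4 * c' * d) / (4 * c'\<^sup>2) * U s + (e'\<^sup>2 - 4 * c' * g) / (4 * c'\<^sup>2)"
      unfolding * using c' by (simp add: add_divide_distrib[symmetric]) (simp add: power2_eq_square algebra_simps)
    finally show "(Y s + b' / (2 * c') * U s + e' / (2 * c'))\<^sup>2
        = (b'\<^sup>2 - 4 * c' * a) / (4 * c'\<^sup>2) * (U s)\<^sup>2
        + (2 * b' * e' - 4 * c' * d) / (4 * c'\<^sup>2) * U s + (e'\<^sup>2 - 4 * c' * g) / (4 * c'\<^sup>2)" .
  next
    fix p q r assume h: "p \<in> S" "q \<in> S" "r \<in> S" "p \<noteq> q" "q \<noteq> r" "p \<noteq> r"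
    have "orient (U p) (Y p) (U q) (Y q) (U r) (Y r) = orient (X p) (Y p) (X q) (Y q) (X r) (Y r)"
      by (simp add: orient_def U_def algebra_simps)
    then show "t ^ 3 \<le> \<bar>orient (U p) (Y p) (U q) (Y q) (U r) (Y r)\<bar>"
      using area[OF h] by simp
  qed (use t fin in auto)
  then show ?thesis by simp
qed

section \<open>Projection of integer zeros to a face of the box\<close>

text \<open>The left-hand side is the determinant with rows \<open>(u, v, w)\<close>. Taking
  \<open>w\<close> out of each row and \<alpha>, \<beta> out of two columns leaves rows
  \<open>(X, Y, 1)\<close>, whose determinant is \<open>orient\<close>.\<close>

lemma det_eq_orient:
  fixes u v w :: "'a \<Rightarrow> real" and \<alpha> \<beta> :: real
  assumes "\<And>s. s \<in> {p, q, r} \<Longrightarrow> u s = \<alpha> * (X s * w s)" "\<And>s. s \<in> {p, q, r} \<Longrightarrow> v s = \<beta> * (Y s * w s)"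
  shows "u p * (v q * w r - v r * w q) - v p * (u q * w r - u r * w q) + w p * (u q * v r - u r * v q)
    = \<alpha> * \<beta> * (w p * w q * w r) * orient (X p) (Y p) (X q) (Y q) (X r) (Y r)"
  using assms by (simp add: orient_def algebra_simps)

text \<open>\<open>(X, Y)\<close> is the central projection to the plane \<open>w = b3\<close>,
  scaled so that the face becomes the square \<open>[-1, 1] * [-1, 1]\<close>. A nonzero integer
  determinant has absolute value at least 1, and \<open>\<bar>w\<bar> \<le> b3\<close>, so every
  \<open>orient\<close> is at least \<open>1 / V\<close> in absolute value;
  \<open>conic_bound\<close> applies with \<open>t = V powr (- 1 / 3)\<close>.\<close>

lemma face_bound:
  fixes u v w :: "'a \<Rightarrow> int" and b1 b2 b3 :: real and a b c d e g :: int
  assumes fin: "finite S" and B: "1 \<le> b1" "1 \<le> b2" "1 \<le> b3"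
    and w: "\<And>s. s \<in> S \<Longrightarrow> w s \<noteq> 0" "\<And>s. s \<in> S \<Longrightarrow> \<bar>real_of_int (w s)\<bar> \<le> b3"
    and u: "\<And>s. s \<in> S \<Longrightarrow> \<bar>real_of_int (u s)\<bar> * b3 \<le> b1 * \<bar>real_of_int (w s)\<bar>"
    and v: "\<And>s. s \<in> S \<Longrightarrow> \<bar>real_of_int (v s)\<bar> * b3 \<le> b2 * \<bar>real_of_int (w s)\<bar>"
    and curve: "\<And>s. s \<in> S \<Longrightarrow> a * (u s)\<^sup>2 + b * u s * v s + c * (v s)\<^sup>2
      + d * u s * w s + e * v s * w s + g * (w s)\<^sup>2 = 0"
    and nonzero: "\<not> (a = 0 \<and> b = 0 \<and> c = 0 \<and> d = 0 \<and> e = 0 \<and> g = 0)"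
    and det: "\<And>p q r. p \<in> S \<Longrightarrow> q \<in> S \<Longrightarrow> r \<in> S \<Longrightarrow> p \<noteq> q \<Longrightarrow> q \<noteq> r \<Longrightarrow> p \<noteq> r \<Longrightarrow>
      u p * (v q * w r - v r * w q) - v p * (u q * w r - u r * w q) + w p * (u q * v r - u r * v q) \<noteq> 0"
  shows "real (card S) \<le> 112 * (b1 * b2 * b3) powr (1 / 3)"
proof -
  define V where "V = b1 * b2 * b3"
  define T where "T = V powr (1 / 3)"
  have b12: "1 \<le> b1 * b2" using mult_mono[of 1 b1 1 b2] B by simp
  have V: "1 \<le> V" using mult_mono[OF b12 B(3)] B by (simp add: V_def)
  have T: "1 \<le> T" using V by (simp add: T_def ge_one_powr_ge_zero)
  have T3: "T ^ 3 = V" using V T by (simp add: T_def powr_powr flip: powr_numeral)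
  define X where "X s = real_of_int (u s) * b3 / (b1 * real_of_int (w s))" for s
  define Y where "Y s = real_of_int (v s) * b3 / (b2 * real_of_int (w s))" for s
  have "real (card S) * (1 / T) \<le> 8 * (1 / T) + 104"
  proof (rule conic_bound[where X = X and Y = Y and a = "a * b1\<^sup>2" and b = "b * b1 * b2" and c = "c * b2\<^sup>2"
        and d = "d * b1 * b3" and e = "e * b2 * b3" and g = "g * b3\<^sup>2"])
    fix s assume s: "s \<in> S"
    show "\<bar>X s\<bar> \<le> 1" "\<bar>Y s\<bar> \<le> 1"
      using w(1)[OF s] u[OF s] v[OF s] B by (simp_all add: X_def Y_def abs_mult divide_le_eq_1)
    \<comment> \<open>The factor that moves the zero to the plane \<open>w = b3\<close>; by
      homogeneity it multiplies the equation by \<open>k\<^sup>2\<close>.\<close>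
    define k where "k = b3 / real_of_int (w s)"
    have k: "b1 * X s = u s * k" "b2 * Y s = v s * k" "b3 = w s * k"
      using B w(1)[OF s] by (simp_all add: X_def Y_def k_def)
    have "a * b1\<^sup>2 * (X s)\<^sup>2 + b * b1 * b2 * X s * Y s + c * b2\<^sup>2 * (Y s)\<^sup>2
        + d * b1 * b3 * X s + e * b2 * b3 * Y s + g * b3\<^sup>2
        = a * (b1 * X s)\<^sup>2 + b * (b1 * X s) * (b2 * Y s) + c * (b2 * Y s)\<^sup>2
        + d * (b1 * X s) * b3 + e * (b2 * Y s) * b3 + g * b3\<^sup>2"
      by (simp add: power2_eq_square mult_ac)
    also have "\<dots> = a * (u s * k)\<^sup>2 + b * (u s * k) * (v s * k) + c * (v s * k)\<^sup>2
        + d * (u s * k) * (w s * k) + e * (v s * k) * (w s * k) + g * (w s * k)\<^sup>2"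
      unfolding k(1,2) k(3)[symmetric] ..
    also have "\<dots> = real_of_int (a * (u s)\<^sup>2 + b * u s * v s + c * (v s)\<^sup>2
        + d * u s * w s + e * v s * w s + g * (w s)\<^sup>2) * k\<^sup>2"
      by (simp add: power2_eq_square algebra_simps)
    finally show "a * b1\<^sup>2 * (X s)\<^sup>2 + b * b1 * b2 * X s * Y s + c * b2\<^sup>2 * (Y s)\<^sup>2
        + d * b1 * b3 * X s + e * b2 * b3 * Y s + g * b3\<^sup>2 = 0"
      unfolding curve[OF s] by simp
  next
    fix p q r assume h: "p \<in> S" "q \<in> S" "r \<in> S" "p \<noteq> q" "q \<noteq> r" "p \<noteq> r"
    define D where "D = u p * (v q * w r - v r * w q) - v p * (u q * w r - u r * w q)
      + w p * (u q * v r - u r * v q)"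
    have "D \<noteq> 0" using det[OF h] by (simp add: D_def)
    then have D: "1 \<le> \<bar>real_of_int D\<bar>" by linarith
    have wle: "\<bar>real_of_int (w p)\<bar> * \<bar>real_of_int (w q)\<bar> * \<bar>real_of_int (w r)\<bar> \<le> b3 * b3 * b3"
      using w(2) h B by (intro mult_mono) auto
    define z where "z = orient (X p) (Y p) (X q) (Y q) (X r) (Y r)"
    have "real_of_int D = b1 / b3 * (b2 / b3) * (real_of_int (w p) * real_of_int (w q) * real_of_int (w r)) * z"
      unfolding z_def D_def of_int_add of_int_diff of_int_mult
      by (rule det_eq_orient) (use B w h in \<open>auto simp: X_def Y_def\<close>)
    then have "\<bar>real_of_int D\<bar> = b1 / b3 * (b2 / b3)
        * (\<bar>real_of_int (w p)\<bar> * \<bar>real_of_int (w q)\<bar> * \<bar>real_of_int (w r)\<bar>) * \<bar>z\<bar>"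
      using B by (simp add: abs_mult)
    also have "\<dots> \<le> b1 / b3 * (b2 / b3) * (b3 * b3 * b3) * \<bar>z\<bar>"
      by (intro mult_right_mono[OF mult_left_mono[OF wle]]) (use B in auto)
    also have "\<dots> = V * \<bar>z\<bar>" using B by (simp add: V_def)
    finally have "1 / V \<le> \<bar>z\<bar>" using D V by (simp add: divide_le_eq mult.commute)
    then show "(1 / T) ^ 3 \<le> \<bar>orient (X p) (Y p) (X q) (Y q) (X r) (Y r)\<bar>"
      by (simp add: power_one_over T3 z_def)
  qed (use T fin B nonzero in auto)
  then have "real (card S) \<le> 8 + 104 * T" using T by (simp add: field_simps)
  then show ?thesis using T by (simp add: T_def V_def)
qed

section \<open>Determinants of isotropic vectors\<close>

definition bilinear_form :: "'a::comm_ring_1 ^ 3 ^ 3 \<Rightarrow> 'a ^ 3 \<Rightarrow> 'a ^ 3 \<Rightarrow> 'a" where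
  "bilinear_form A x y = (\<Sum>i\<in>UNIV. \<Sum>j\<in>UNIV. A $ i $ j * x $ i * y $ j)"

text \<open>The right-hand side is the expanded determinant of the Gram matrix
  \<open>P ** A ** transpose P\<close>, where \<open>P\<close> has rows \<open>p\<close>,
  \<open>q\<close>, \<open>r\<close>.\<close>

lemma det_gram:
  fixes A :: "'a::field ^ 3 ^ 3"
  defines "\<beta> \<equiv> bilinear_form A"
  assumes "transpose A = A"
  shows "(det (vector [p, q, r]))\<^sup>2 * det A =
    \<beta> p p * \<beta> q q * \<beta> r r + 2 * \<beta> p q * \<beta> q r * \<beta> p r
    - \<beta> p p * (\<beta> q r)\<^sup>2 - \<beta> q q * (\<beta> p r)\<^sup>2 - \<beta> r r * (\<beta> p q)\<^sup>2"
proof -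
  define P :: "'a ^ 3 ^ 3" where "P = vector [p, q, r]"
  have sym: "A $ i $ j = A $ j $ i" for i j
    using arg_cong[OF assms(2), of "\<lambda>M. M $ j $ i"] by (simp add: transpose_def)
  have \<beta>sym: "\<beta> x y = \<beta> y x" for x y
    by (simp add: \<beta>_def bilinear_form_def sum_3 sym[of 2 1] sym[of 3 1] sym[of 3 2] algebra_simps)
  have G: "(P ** A ** transpose P) $ i $ j = \<beta> (P $ i) (P $ j)" for i j
    by (simp add: matrix_matrix_mult_def transpose_def \<beta>_def bilinear_form_def sum_3 algebra_simps)
  have "(det P)\<^sup>2 * det A = det (P ** A ** transpose P)"
    by (simp add: det_mul power2_eq_square)
  also have "\<dots> = \<beta> p p * \<beta> q q * \<beta> r r + 2 * \<beta> p q * \<beta> q r * \<beta> p r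
    - \<beta> p p * (\<beta> q r)\<^sup>2 - \<beta> q q * (\<beta> p r)\<^sup>2 - \<beta> r r * (\<beta> p q)\<^sup>2"
    unfolding det_3 G by (simp add: P_def \<beta>sym[of q p] \<beta>sym[of r p] \<beta>sym[of r q] power2_eq_square algebra_simps)
  finally show ?thesis by (simp add: P_def)
qed

text \<open>Vanishing of all 2 by 2 minors: free of division, so that it serves integer and rational
  vectors alike. The zero vector is parallel to every vector.\<close>

definition parallel :: "'a::times ^ 3 \<Rightarrow> 'a ^ 3 \<Rightarrow> bool" where
  "parallel x y \<longleftrightarrow> (\<forall>i j. x $ i * y $ j = x $ j * y $ i)"

text \<open>The Gram determinant of \<open>p\<close>, \<open>q\<close>, \<open>e\<close> vanishes
  for every \<open>e\<close>. Taking the unit vectors for \<open>e\<close> yields the 2 by 2 minors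
  of \<open>p\<close> and \<open>q\<close>.\<close>

lemma no_isotropic_plane:
  fixes A :: "'a::field ^ 3 ^ 3"
  assumes A: "transpose A = A" "det A \<noteq> 0"
    and p: "bilinear_form A p p = 0" and q: "bilinear_form A q q = 0" and pq: "bilinear_form A p q = 0"
  shows "parallel p q"
proof -
  have "det (vector [p, q, e]) = 0" for e
    using det_gram[OF A(1), of p q e] A(2) p q pq by simp
  from this[of "vector [1, 0, 0]"] this[of "vector [0, 1, 0]"] this[of "vector [0, 0, 1]"]
  show ?thesis by (simp add: parallel_def forall_3 det_3 mult.commute)
qed

text \<open>With zero diagonal the Gram determinant is twice the product of the three mixed values,
  none of which vanishes by \<open>no_isotropic_plane\<close>.\<close>

lemma isotropic_det_nonzero:
  fixes A :: "'a::field_char_0 ^ 3 ^ 3"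
  assumes A: "transpose A = A" "det A \<noteq> 0"
    and "bilinear_form A p p = 0" "bilinear_form A q q = 0" "bilinear_form A r r = 0"
    and "\<not> parallel p q" "\<not> parallel q r" "\<not> parallel p r"
  shows "det (vector [p, q, r]) \<noteq> 0"
  using det_gram[OF A(1), of p q r] no_isotropic_plane[OF A] assms(3-) by auto

lemma primitive_parallel:
  fixes x y :: "int ^ 3"
  assumes "Gcd {x $ 1, x $ 2, x $ 3} = 1" "Gcd {y $ 1, y $ 2, y $ 3} = 1" "parallel x y"
  shows "y = x \<or> y = - x"
proof -
  obtain a b where ab: "a * x $ 2 + b * x $ 3 = gcd (x $ 2) (x $ 3)"
    using bezout_int by blast
  obtain c d where "c * x $ 1 + d * gcd (x $ 2) (x $ 3) = gcd (x $ 1) (gcd (x $ 2) (x $ 3))"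
    using bezout_int by blast
  then have one: "c * x $ 1 + d * (a * x $ 2 + b * x $ 3) = 1"
    using assms(1) by (simp add: ab)
  \<comment> \<open>The Bezout combination that takes the value 1 at \<open>x\<close>, evaluated at
    \<open>y\<close>. Parallelism gives \<open>y = k * x\<close>, and primitivity of
    \<open>y\<close> makes \<open>k\<close> a unit.\<close>
  define k where "k = c * y $ 1 + d * (a * y $ 2 + b * y $ 3)"
  have y: "y $ j = k * x $ j" for j
  proof -
    have "y $ j = (c * x $ 1 + d * (a * x $ 2 + b * x $ 3)) * y $ j" by (simp add: one)
    also have "\<dots> = c * (x $ 1 * y $ j) + d * (a * (x $ 2 * y $ j) + b * (x $ 3 * y $ j))"
      by (simp add: algebra_simps)
    also have "\<dots> = c * (x $ j * y $ 1) + d * (a * (x $ j * y $ 2) + b * (x $ j * y $ 3))"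
      using assms(3) by (simp add: parallel_def)
    also have "\<dots> = k * x $ j" by (simp add: k_def algebra_simps)
    finally show ?thesis .
  qed
  have "k dvd Gcd {y $ 1, y $ 2, y $ 3}"
    by (rule Gcd_greatest) (auto simp: y)
  then have "k = 1 \<or> k = - 1" unfolding assms(2) by (simp add: abs_if split: if_splits)
  then show ?thesis using y by (auto simp: vec_eq_iff)
qed

text \<open>The argument passes to rational vectors because \<open>form_matrix\<close> may have
  half-integral entries.\<close>

lemma isotropic_int_det_nonzero:
  fixes x y z :: "int ^ 3"
  assumes Q: "nonsingular Q"
    and 0: "form_eval Q x = 0" "form_eval Q y = 0" "form_eval Q z = 0"
    and np: "\<not> parallel x y" "\<not> parallel y z" "\<not> parallel x z"
  shows "det (vector [x, y, z]) \<noteq> 0"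
proof -
  define R :: "int ^ 3 \<Rightarrow> rat ^ 3" where "R x = (\<chi> i. of_int (x $ i))" for x
  have iso: "bilinear_form (form_matrix Q) (R w) (R w) = 0" if "form_eval Q w = 0" for w
  proof -
    have "bilinear_form (form_matrix Q) (R w) (R w) = form_eval Q (R w)"
      by (simp add: bilinear_form_def form_eval_eq_matrix)
    also have "\<dots> = of_int (form_eval Q w)" by (simp add: form_eval_def R_def)
    finally show ?thesis using that by simp
  qed
  have par: "parallel (R v) (R w) \<longleftrightarrow> parallel v w" for v w
    by (simp add: parallel_def R_def flip: of_int_mult)
  have "det (vector [R x, R y, R z]) = of_int (det (vector [x, y, z]))"
    by (simp add: det_3 R_def)
  moreover have "det (vector [R x, R y, R z]) \<noteq> 0"
    using isotropic_det_nonzero[OF form_matrix_symmetric] Q iso 0 np par unfolding nonsingular_def by blast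
  ultimately show ?thesis by auto
qed

lemma nonsingular_imp_nonzero:
  assumes "nonsingular Q"
  shows "\<not> (c11 Q = 0 \<and> c22 Q = 0 \<and> c33 Q = 0 \<and> c12 Q = 0 \<and> c13 Q = 0 \<and> c23 Q = 0)"
  using assms by (auto simp: nonsingular_def form_matrix_def det_3)

section \<open>Counting the zeros face by face\<close>

text \<open>\<open>face\<close> places the projected zeros on the pair of opposite faces with index
  \<open>i\<close>, and \<open>sign\<close> selects one of the two. Thus \<open>x\<close> and
  \<open>- x\<close> are never both in \<open>S\<close>, and distinct primitive zeros in
  \<open>S\<close> are not parallel.\<close>

lemma isotropic_face_bound:
  fixes B :: "real ^ 3" and S :: "(int ^ 3) set" and i :: 3
  assumes Q: "nonsingular Q" and B: "\<And>j. 1 \<le> B $ j" and fin: "finite S"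
    and prim: "\<And>x. x \<in> S \<Longrightarrow> Gcd {x $ 1, x $ 2, x $ 3} = 1"
    and zero: "\<And>x. x \<in> S \<Longrightarrow> form_eval Q x = 0"
    and box: "\<And>x. x \<in> S \<Longrightarrow> \<bar>real_of_int (x $ i)\<bar> \<le> B $ i"
    and face: "\<And>x j. x \<in> S \<Longrightarrow> \<bar>real_of_int (x $ j)\<bar> * B $ i \<le> B $ j * \<bar>real_of_int (x $ i)\<bar>"
    and sign: "\<And>x y. x \<in> S \<Longrightarrow> y \<in> S \<Longrightarrow> 0 < x $ i * y $ i"
  shows "real (card S) \<le> 112 * (B $ 1 * B $ 2 * B $ 3) powr (1 / 3)"
proof -
  have nz: "x $ i \<noteq> 0" if "x \<in> S" for x using sign[OF that that] by auto
  have "\<not> parallel x y" if "x \<in> S" "y \<in> S" "x \<noteq> y" for x y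
  proof
    assume "parallel x y"
    then have "y = - x" using primitive_parallel[of x y] prim that by auto
    then have "x $ i * y $ i \<le> 0" by simp
    then show False using sign[of x y] that by simp
  qed
  then have det: "det (vector [x, y, z]) \<noteq> 0"
    if "x \<in> S" "y \<in> S" "z \<in> S" "x \<noteq> y" "y \<noteq> z" "x \<noteq> z" for x y z
    using that isotropic_int_det_nonzero[OF Q] zero by simp
  note nonzero = nonsingular_imp_nonzero[OF Q]
  \<comment> \<open>The determinant with its columns permuted, equal to the original up to sign; the
    last index is that of the face.\<close>
  let ?D = "\<lambda>(i::3) j k (p::int ^ 3) q r. p $ i * (q $ j * r $ k - r $ j * q $ k)
    - p $ j * (q $ i * r $ k - r $ i * q $ k) + p $ k * (q $ i * r $ j - r $ i * q $ j)"
  have D: "?D 2 3 1 p q r \<noteq> 0" "?D 1 3 2 p q r \<noteq> 0" "?D 1 2 3 p q r \<noteq> 0"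
    if "p \<in> S" "q \<in> S" "r \<in> S" "p \<noteq> q" "q \<noteq> r" "p \<noteq> r" for p q r
    using det[OF that] by (simp_all add: det_3 algebra_simps)
  consider "i = 1" | "i = 2" | "i = 3" using exhaust_3 by blast
  then show ?thesis
  proof cases
    case 1
    have "c22 Q * (x $ 2)\<^sup>2 + c23 Q * x $ 2 * x $ 3 + c33 Q * (x $ 3)\<^sup>2
        + c12 Q * x $ 2 * x $ 1 + c13 Q * x $ 3 * x $ 1 + c11 Q * (x $ 1)\<^sup>2 = 0" if "x \<in> S" for x
      using zero[OF that] by (simp add: form_eval_def algebra_simps)
    then have "real (card S) \<le> 112 * (B $ 2 * B $ 3 * B $ 1) powr (1 / 3)"
      by (intro face_bound[of S _ _ _ "\<lambda>x. x $ 1" "\<lambda>x. x $ 2" "\<lambda>x. x $ 3"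
            "c22 Q" "c23 Q" "c33 Q" "c12 Q" "c13 Q" "c11 Q"] fin B D(1))
        (use nz box face nonzero 1 in auto)
    then show ?thesis by (simp add: mult_ac)
  next
    case 2
    have "c11 Q * (x $ 1)\<^sup>2 + c13 Q * x $ 1 * x $ 3 + c33 Q * (x $ 3)\<^sup>2
        + c12 Q * x $ 1 * x $ 2 + c23 Q * x $ 3 * x $ 2 + c22 Q * (x $ 2)\<^sup>2 = 0" if "x \<in> S" for x
      using zero[OF that] by (simp add: form_eval_def algebra_simps)
    then have "real (card S) \<le> 112 * (B $ 1 * B $ 3 * B $ 2) powr (1 / 3)"
      by (intro face_bound[of S _ _ _ "\<lambda>x. x $ 2" "\<lambda>x. x $ 1" "\<lambda>x. x $ 3"
            "c11 Q" "c13 Q" "c33 Q" "c12 Q" "c23 Q" "c22 Q"] fin B D(2))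
        (use nz box face nonzero 2 in auto)
    then show ?thesis by (simp add: mult_ac)
  next
    case 3
    have "c11 Q * (x $ 1)\<^sup>2 + c12 Q * x $ 1 * x $ 2 + c22 Q * (x $ 2)\<^sup>2
        + c13 Q * x $ 1 * x $ 3 + c23 Q * x $ 2 * x $ 3 + c33 Q * (x $ 3)\<^sup>2 = 0" if "x \<in> S" for x
      using zero[OF that] by (simp add: form_eval_def algebra_simps)
    then show ?thesis
      by (intro face_bound[of S _ _ _ "\<lambda>x. x $ 3" "\<lambda>x. x $ 1" "\<lambda>x. x $ 2"
            "c11 Q" "c12 Q" "c22 Q" "c13 Q" "c23 Q" "c33 Q"] fin B D(3))
        (use nz box face nonzero 3 in auto)
  qed
qed

theorem theorem6:
  "\<exists>C::real. C > 0 \<and>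
     (\<forall>(Q::ternary_form) (B::real ^ 3).
        nonsingular Q \<longrightarrow> (\<forall>i. 1 \<le> B $ i) \<longrightarrow>
        real (N Q B) \<le> C * (\<Prod>i\<in>UNIV. B $ i) powr (1 / 3))"
proof (intro exI[of _ 672] conjI allI impI)
  fix Q :: ternary_form and B :: "real ^ 3"
  assume Q: "nonsingular Q" and B_ge: "\<forall>i. 1 \<le> B $ i"
  have B: "1 \<le> B $ i" for i by (rule B_ge[rule_format])
  define S where "S = {x :: int ^ 3. Gcd {x $ 1, x $ 2, x $ 3} = 1 \<and> form_eval Q x = 0 \<and>
    (\<forall>i. real_of_int \<bar>x $ i\<bar> \<le> B $ i)}"
  have fin: "finite S" unfolding S_def by (rule finite_N_set)
  \<comment> \<open>The zeros whose ray from the origin leaves the box through the face where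
    coordinate \<open>i\<close> equals \<open>s * B $ i\<close>. There are six faces, and
    \<open>672 = 6 * 112\<close>.\<close>
  define F where "F = (\<lambda>(i, s). {x \<in> S. 0 < s * x $ i \<and>
    (\<forall>j. \<bar>real_of_int (x $ j)\<bar> * B $ i \<le> B $ j * \<bar>real_of_int (x $ i)\<bar>)})"
  define I where "I = (UNIV :: 3 set) \<times> {1, - 1 :: int}"
  have I: "finite I" "card I = 6" by (simp_all add: I_def)
  have vol: "(\<Prod>i\<in>UNIV. B $ i) = B $ 1 * B $ 2 * B $ 3"
    unfolding UNIV_3 by (simp add: mult_ac)
  have "S \<subseteq> (\<Union>f\<in>I. F f)"
  proof
    fix x assume x: "x \<in> S"
    \<comment> \<open>A largest rescaled coordinate determines a face that the ray meets. It is
      nonzero because a primitive vector is nonzero.\<close>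
    define h where "h j = \<bar>real_of_int (x $ j)\<bar> / B $ j" for j
    have "Max (range h) \<in> range h" by (rule Max_in) auto
    then obtain i where "h i = Max (range h)" by (metis imageE)
    then have i: "h j \<le> h i" for j by simp
    have B0: "0 < B $ j" for j using B[of j] by linarith
    have le: "\<bar>real_of_int (x $ j)\<bar> * B $ i \<le> B $ j * \<bar>real_of_int (x $ i)\<bar>" for j
      using i[of j] B0[of i] B0[of j] by (simp add: h_def field_simps)
    have "x $ i \<noteq> 0"
    proof
      assume 0: "x $ i = 0"
      have "x $ j = 0" for j
      proof -
        have "\<bar>real_of_int (x $ j)\<bar> * B $ i \<le> 0" using le[of j] unfolding 0 by simp
        then show ?thesis using B0[of i] by (simp add: mult_le_0_iff)
      qed
      then have "Gcd {x $ 1, x $ 2, x $ 3} = 0" by simp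
      then show False using x by (simp add: S_def)
    qed
    then consider "0 < x $ i" | "x $ i < 0" by linarith
    then show "x \<in> (\<Union>f\<in>I. F f)"
    proof cases
      case 1
      then have "x \<in> F (i, 1)" using x le by (simp add: F_def)
      then show ?thesis by (rule UN_I[rotated]) (simp add: I_def)
    next
      case 2
      then have "x \<in> F (i, - 1)" using x le by (simp add: F_def)
      then show ?thesis by (rule UN_I[rotated]) (simp add: I_def)
    qed
  qed
  then have "card S \<le> card (\<Union>f\<in>I. F f)"
    using fin I by (intro card_mono) (auto simp: F_def)
  also have "\<dots> \<le> (\<Sum>f\<in>I. card (F f))" using I by (intro card_UN_le)
  finally have "real (card S) \<le> (\<Sum>f\<in>I. real (card (F f)))"
    by (simp flip: of_nat_sum)
  also have "\<dots> \<le> (\<Sum>f\<in>I. 112 * (B $ 1 * B $ 2 * B $ 3) powr (1 / 3))"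
  proof (rule sum_mono)
    fix f assume "f \<in> I"
    then obtain i s where f: "f = (i, s)" "s = 1 \<or> s = - 1" by (auto simp: I_def)
    show "real (card (F f)) \<le> 112 * (B $ 1 * B $ 2 * B $ 3) powr (1 / 3)"
    proof (rule isotropic_face_bound[OF Q B, where i = i])
      have sub: "F f \<subseteq> S" by (auto simp: F_def f)
      then show "finite (F f)" using fin by (rule finite_subset)
      fix x assume x: "x \<in> F f"
      then have "x \<in> S" using sub by blast
      then show "Gcd {x $ 1, x $ 2, x $ 3} = 1" "form_eval Q x = 0" "\<bar>real_of_int (x $ i)\<bar> \<le> B $ i"
        by (simp_all add: S_def)
      show "\<bar>real_of_int (x $ j)\<bar> * B $ i \<le> B $ j * \<bar>real_of_int (x $ i)\<bar>" for j
        using x by (simp add: F_def f)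
      show "0 < x $ i * y $ i" if "y \<in> F f" for y
        using x that f(2) by (auto simp: F_def f(1) zero_less_mult_iff)
    qed
  qed
  also have "\<dots> = 672 * (\<Prod>i\<in>UNIV. B $ i) powr (1 / 3)"
    unfolding vol using I by simp
  finally show "real (N Q B) \<le> 672 * (\<Prod>i\<in>UNIV. B $ i) powr (1 / 3)"
    by (simp add: N_def S_def)
qed simp

end
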